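(* Let $n, m \geq 1$ be integers, let $N_1, \dots, N_m$ be norms on $M(1)$ satisfying (i)--(v), let $h$ be a real-valued function of $m$ distance-matrix variables, and for all $k \geq 1$ and $X_1, \dots, X_m \in M(n \times k)$ put $$H(X_1, \dots, X_m) = h(D(N_1, X_1), \dots, D(N_m, X_m)).$$ Then $H$ has a limit as the number of columns increases if and only if $H$ is constant.
   Context: $M(n \times k)$ is the set of real $n \times k$ matrices ($n,k\ge 1$), and $M(n) = \bigcup_{k \geq 1} M(n \times k)$; in particular $M(1)$ is the set of all real row vectors of any finite length. $0(n\times k)$ is the zero matrix in $M(n\times k)$. A norm on $M(1)$ is a function $N : M(1) \to \mathbb{R}$ such that for all $v, w \in M(1)$ and $c \in \mathbb{R}$: (i) $N(v) = 0$ if $v = 0(1\times k)$ for some $k$, and $N(v) > 0$ otherwise; (ii) $N(cv) = |c| N(v)$; (iii) $N(v+w) \leq N(v) + N(w)$ whenever $v$ and $w$ have the same number of columns. The norms considered are also assumed to satisfy: (iv) $N(v) = N(v')$ if $v$ is not a zero vector and $v'$ is obtained from $v$ by removing all its zero entries; (v) $N([1]) = 1$. For $X \in M(n \times k)$ with $i$-th row $x(i)$, the distance matrix $D(N,X)$ is the $n \times n$ matrix whose $(i,j)$ entry is $N(x(j) - x(i))$. The function $h$ is real-valued and defined on $\mathcal{D}_1 \times \cdots \times \mathcal{D}_m$, where $\mathcal{D}_i = \{D(N_i, X) : X \in M(n)\}$. The arguments $X_1,\dots,X_m$ of $H$ always have $n$ rows and a common number $k$ of columns, where $k \geq 1$ is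 arbitrary; so the domain of $H$ is $\bigcup_{k \geq 1} M(n\times k)^m$. The integer $n$ is held fixed as $k$ increases. "$H$ has a limit as the number of columns increases" means: there is $a \in \mathbb{R}$ such that for every $\varepsilon > 0$ there is $K$ such that $|H(X_1,\dots,X_m) - a| < \varepsilon$ for all $k \geq K$ and all $X_1, \dots, X_m \in M(n \times k)$. *)

theory Defs
  imports Complex_Main "Jordan_Normal_Form.Matrix"
begin

text \<open>Row vectors of any positive length, i.e. $M(1)$. The type \<^typ>\<open>real vec\<close> also contains
  an empty vector, which is not a member of $M(1)$.\<close>
definition row_vecs :: "real vec set" where
  "row_vecs = {v. dim_vec v \<ge> 1}"

definition remove_zeros :: "real vec \<Rightarrow> real vec" where
  "remove_zeros v = vec_of_list (filter (\<lambda>x. x \<noteq> 0) (list_of_vec v))"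

definition is_norm_M1 :: "(real vec \<Rightarrow> real) \<Rightarrow> bool" where
  "is_norm_M1 N \<longleftrightarrow>
     (\<forall>v\<in>row_vecs. if v = 0\<^sub>v (dim_vec v) then N v = 0 else N v > 0) \<and>
     (\<forall>v\<in>row_vecs. \<forall>c::real. N (c \<cdot>\<^sub>v v) = \<bar>c\<bar> * N v) \<and>
     (\<forall>v\<in>row_vecs. \<forall>w\<in>row_vecs. dim_vec v = dim_vec w \<longrightarrow> N (v + w) \<le> N v + N w) \<and>
     (\<forall>v\<in>row_vecs. v \<noteq> 0\<^sub>v (dim_vec v) \<longrightarrow> N v = N (remove_zeros v)) \<and>
     N (vec_of_list [1]) = 1"

definition distance_matrix :: "(real vec \<Rightarrow> real) \<Rightarrow> real mat \<Rightarrow> real mat" where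
  "distance_matrix N X =
     mat (dim_row X) (dim_row X) (\<lambda>(i, j). N (row X j - row X i))"

text \<open>$M(n \times k)^m$, with $m$-tuples represented as lists of length $m$.\<close>
definition mat_tuples :: "nat \<Rightarrow> nat \<Rightarrow> nat \<Rightarrow> real mat list set" where
  "mat_tuples m n k = {Xs. length Xs = m \<and> set Xs \<subseteq> carrier_mat n k}"

definition H_domain :: "nat \<Rightarrow> nat \<Rightarrow> real mat list set" where
  "H_domain m n = (\<Union>k\<in>{1..}. mat_tuples m n k)"

definition has_column_limit :: "nat \<Rightarrow> nat \<Rightarrow> (real mat list \<Rightarrow> real) \<Rightarrow> bool" where
  "has_column_limit m n H \<longleftrightarrow>
     (\<exists>a. \<forall>\<epsilon>>0. \<exists>K. \<forall>k\<ge>K. k \<ge> 1 \<longrightarrow> (\<forall>Xs\<in>mat_tuples m n k. \<bar>H Xs - a\<bar> < \<epsilon>))"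

end

theory Submission
  imports Defs
begin

text \<open>
  A norm satisfying the zero-removal axiom does not see trailing zeros. Hence appending zero
  columns to every argument changes none of the distance matrices, and so leaves \<open>H\<close> unchanged
  while the number of columns becomes as large as desired. Every value of \<open>H\<close> is therefore
  attained at all larger numbers of columns, so each value is arbitrarily close to the limit,
  that is, equal to it. Conversely, a constant function has its value as limit.
\<close>

definition pad_cols :: "nat \<Rightarrow> real mat \<Rightarrow> real mat" where
  "pad_cols p X = mat (dim_row X) (dim_col X + p)
     (\<lambda>(i, j). if j < dim_col X then X $$ (i, j) else 0)"

lemma list_of_vec_append_vec:
  "list_of_vec (v @\<^sub>v w) = list_of_vec v @ list_of_vec w"
  by (rule nth_equalityI) (auto simp: list_of_vec_index nth_append)

lemma remove_zeros_append_zero: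
  "remove_zeros (v @\<^sub>v 0\<^sub>v p) = remove_zeros v"
proof -
  have "filter (\<lambda>x. x \<noteq> 0) (list_of_vec (0\<^sub>v p :: real vec)) = []"
    by (auto simp: filter_empty_conv in_set_conv_nth list_of_vec_index)
  then show ?thesis
    by (simp add: remove_zeros_def list_of_vec_append_vec)
qed

text \<open>The zero-removal axiom speaks of nonzero vectors only; for the zero vector both sides vanish
  by definiteness.\<close>
lemma norm_append_zero:
  assumes N: "is_norm_M1 N" and v: "v \<in> row_vecs"
  shows "N (v @\<^sub>v 0\<^sub>v p) = N v"
proof -
  let ?w = "v @\<^sub>v 0\<^sub>v p"
  have w: "?w \<in> row_vecs"
    using v by (simp add: row_vecs_def)
  have zero: "N u = 0" if "u \<in> row_vecs" "u = 0\<^sub>v (dim_vec u)" for u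
    using N that unfolding is_norm_M1_def by auto
  have remove: "N u = N (remove_zeros u)" if "u \<in> row_vecs" "u \<noteq> 0\<^sub>v (dim_vec u)" for u
    using N that unfolding is_norm_M1_def by blast
  have iff: "?w = 0\<^sub>v (dim_vec ?w) \<longleftrightarrow> v = 0\<^sub>v (dim_vec v)"
  proof
    assume eq: "?w = 0\<^sub>v (dim_vec ?w)"
    have "v $ i = 0" if "i < dim_vec v" for i
    proof -
      have "?w $ i = 0\<^sub>v (dim_vec ?w) $ i"
        using eq by (rule arg_cong)
      then show ?thesis
        using that by simp
    qed
    then show "v = 0\<^sub>v (dim_vec v)"
      by auto
  next
    assume eq: "v = 0\<^sub>v (dim_vec v)"
    have "v $ i = 0" if "i < dim_vec v" for i
      using that by (subst eq) simp
    then show "?w = 0\<^sub>v (dim_vec ?w)"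
      by (intro eq_vecI) auto
  qed
  show ?thesis
  proof (cases "v = 0\<^sub>v (dim_vec v)")
    case True
    then show ?thesis
      using zero[OF v] zero[OF w] iff by simp
  next
    case False
    then have "N ?w = N (remove_zeros ?w)"
      using remove[OF w] iff by simp
    also have "\<dots> = N v"
      using remove[OF v False] by (simp only: remove_zeros_append_zero)
    finally show ?thesis .
  qed
qed

lemma distance_matrix_pad_cols:
  assumes N: "is_norm_M1 N" and X: "dim_col X \<ge> 1"
  shows "distance_matrix N (pad_cols p X) = distance_matrix N X"
proof -
  have "N (row (pad_cols p X) j - row (pad_cols p X) i) = N (row X j - row X i)"
    if "i < dim_row X" "j < dim_row X" for i j
  proof -
    have "row (pad_cols p X) j - row (pad_cols p X) i = (row X j - row X i) @\<^sub>v 0\<^sub>v p"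
      by (rule eq_vecI) (use that in \<open>auto simp: pad_cols_def\<close>)
    then show ?thesis
      using norm_append_zero[OF N] X by (simp add: row_vecs_def)
  qed
  then show ?thesis
    by (intro eq_matI) (auto simp: distance_matrix_def pad_cols_def)
qed

lemma pad_cols_mat_tuples:
  assumes "Xs \<in> mat_tuples m n k"
  shows "map (pad_cols p) Xs \<in> mat_tuples m n (k + p)"
  using assms by (auto simp: mat_tuples_def pad_cols_def)

lemma map2_distance_matrix_pad_cols:
  assumes Xs: "Xs \<in> mat_tuples m n k" and "k \<ge> 1"
    and Ns: "\<forall>N\<in>set Ns. is_norm_M1 N"
  shows "map2 distance_matrix Ns (map (pad_cols p) Xs) = map2 distance_matrix Ns Xs"
proof (rule nth_equalityI)
  fix i assume "i < length (map2 distance_matrix Ns (map (pad_cols p) Xs))"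
  then have i: "i < length Ns" "i < length Xs"
    by auto
  then have "Xs ! i \<in> carrier_mat n k"
    using Xs by (auto simp: mat_tuples_def)
  then have "dim_col (Xs ! i) \<ge> 1"
    using \<open>k \<ge> 1\<close> by auto
  then show "map2 distance_matrix Ns (map (pad_cols p) Xs) ! i = map2 distance_matrix Ns Xs ! i"
    using i Ns by (simp add: distance_matrix_pad_cols)
qed simp

theorem mainTheorem1:
  fixes n m :: nat
    and Ns :: "(real vec \<Rightarrow> real) list"
    and h H :: "real mat list \<Rightarrow> real"
  assumes "n \<ge> 1" and "m \<ge> 1"
    and "length Ns = m"
    and "\<forall>N\<in>set Ns. is_norm_M1 N"
    and "\<forall>Xs\<in>H_domain m n. H Xs = h (map2 distance_matrix Ns Xs)"
  shows "has_column_limit m n H \<longleftrightarrow> (\<exists>c. \<forall>Xs\<in>H_domain m n. H Xs = c)"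
proof
  assume "has_column_limit m n H"
  then obtain a where a: "\<And>\<epsilon>. \<epsilon> > 0 \<Longrightarrow>
      \<exists>K. \<forall>k\<ge>K. k \<ge> 1 \<longrightarrow> (\<forall>Xs\<in>mat_tuples m n k. \<bar>H Xs - a\<bar> < \<epsilon>)"
    unfolding has_column_limit_def by blast
  have "H Xs = a" if "Xs \<in> H_domain m n" for Xs
  proof -
    obtain k where k: "k \<ge> 1" and Xs: "Xs \<in> mat_tuples m n k"
      using \<open>Xs \<in> H_domain m n\<close> by (auto simp: H_domain_def)
    have "\<bar>H Xs - a\<bar> < \<epsilon>" if "\<epsilon> > 0" for \<epsilon>
    proof -
      obtain K where K: "\<And>k Ys. k \<ge> K \<Longrightarrow> k \<ge> 1 \<Longrightarrow> Ys \<in> mat_tuples m n k \<Longrightarrow> \<bar>H Ys - a\<bar> < \<epsilon>"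
        using a[OF \<open>\<epsilon> > 0\<close>] by blast
      let ?Ys = "map (pad_cols K) Xs"
      have Ys: "?Ys \<in> mat_tuples m n (k + K)"
        using Xs by (rule pad_cols_mat_tuples)
      then have "?Ys \<in> H_domain m n"
        using k unfolding H_domain_def by (intro UN_I[of "k + K"]) auto
      then have "H ?Ys = H Xs"
        using assms(5) \<open>Xs \<in> H_domain m n\<close>
        by (simp only: map2_distance_matrix_pad_cols[OF Xs k assms(4)])
      moreover have "\<bar>H ?Ys - a\<bar> < \<epsilon>"
        using K[OF _ _ Ys] k by simp
      ultimately show ?thesis
        by simp
    qed
    from this[of "\<bar>H Xs - a\<bar>"] show ?thesis
      by auto
  qed
  then show "\<exists>c. \<forall>Xs\<in>H_domain m n. H Xs = c"
    by blast
next
  assume "\<exists>c. \<forall>Xs\<in>H_domain m n. H Xs = c"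
  then obtain c where "\<forall>Xs\<in>H_domain m n. H Xs = c"
    by blast
  then have "\<bar>H Xs - c\<bar> < \<epsilon>" if "\<epsilon> > 0" "k \<ge> 1" "Xs \<in> mat_tuples m n k" for \<epsilon> k Xs
    using that by (auto simp: H_domain_def)
  then show "has_column_limit m n H"
    unfolding has_column_limit_def by blast
qed

end
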